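(* Let $G$ and $H$ be finite groups. Then there is a bijective correspondence between (a) the set of all sections $(T,S)$ of $G\times H$, and (b) the set of all pairs $((P_1,K_1,\eta_1,L_1,Q_1),(P_2,K_2,\eta_2,L_2,Q_2))$ of Goursat quintuples (for $G\times H$) satisfying the following conditions: (S3) $K_2\unlhd K_1$ and $L_2\unlhd L_1$; (S4) $K_2,P_2\unlhd P_1$ and $L_2,Q_2\unlhd Q_1$; (S5) $[K_1,P_2]\le K_2$ and $[L_1,Q_2]\le L_2$; (S6) $(P_2/K_2,P_1/K_1,\partial)$ and $(Q_2/L_2,Q_1/L_1,\partial)$ are crossed modules, where $\partial$ is given by $\partial(xA_2)=xA_1$ for $A\in\{K,L\}$ and in both cases the action is given by conjugation; (S7) $(\eta_2,\eta_1):(Q_2/L_2,Q_1/L_1,\partial)\to(P_2/K_2,P_1/K_1,\partial)$ is an isomorphism of crossed modules. The correspondence is given by mapping a section $(T,S)$ of $G\times H$ to the pair of Goursat correspondents of $T$ and $S$.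
   Context: A section of a group $X$ is a pair $(T,S)$ of subgroups with $S\unlhd T\le X$. For $U\le G\times H$ put $p_1(U)=\{g\in G:(g,h)\in U\text{ for some }h\in H\}$, $p_2(U)=\{h\in H:(g,h)\in U\text{ for some }g\in G\}$, $k_1(U)=\{g\in G:(g,1)\in U\}$, $k_2(U)=\{h\in H:(1,h)\in U\}$, and $\eta_U:p_2(U)/k_2(U)\to p_1(U)/k_1(U)$, $h\,k_2(U)\mapsto g\,k_1(U)$ whenever $(g,h)\in U$ (a group isomorphism). A Goursat quintuple is a quintuple $(P,K,\eta,L,Q)$ with $K\unlhd P\le G$, $L\unlhd Q\le H$ and $\eta:Q/L\to P/K$ a group isomorphism. The Goursat correspondent of $U$ is the quintuple $(p_1(U),k_1(U),\eta_U,k_2(U),p_2(U))$. A crossed module is a triple $(A,G,\partial)$ where $G$ is a group acting on a group $A$ (written $(g,a)\mapsto{}^ga$) by automorphisms and $\partial:A\to G$ is a group homomorphism such that $\partial({}^ga)=g\,\partial(a)\,g^{-1}$ and ${}^{\partial(b)}a=bab^{-1}$ for all $g\in G$, $a,b\in A$. A morphism $(A,G,\partial)\to(A',G',\partial')$ is a pair $(\alpha,\beta)$ of group homomorphisms $\alpha:A\to A'$, $\beta:G\to G'$ with $\partial'\circ\alpha=\beta\circ\partial$ and $\alpha({}^ga)={}^{\beta(g)}\alpha(a)$; it is an isomorphism if $\alpha$ and $\beta$ are both isomorphisms. *)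

theory Defs
  imports "HOL-Algebra.Coset" "HOL-Algebra.Bij" "HOL-Algebra.Generated_Groups"
begin

section \<open>Goursat quintuples\<close>

definition sections :: "('a, 'm) monoid_scheme \<Rightarrow> ('a set \<times> 'a set) set" where
  "sections X = {(T, S). subgroup T X \<and> S \<lhd> X\<lparr>carrier := T\<rparr>}"

abbreviation quot :: "('a, 'm) monoid_scheme \<Rightarrow> 'a set \<Rightarrow> 'a set \<Rightarrow> 'a set monoid" where
  "quot G P K \<equiv> G\<lparr>carrier := P\<rparr> Mod K"

definition p1 :: "('a, 'm) monoid_scheme \<Rightarrow> ('b, 'n) monoid_scheme \<Rightarrow> ('a \<times> 'b) set \<Rightarrow> 'a set" where
  "p1 G H U = {g \<in> carrier G. \<exists>h \<in> carrier H. (g, h) \<in> U}"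

definition p2 :: "('a, 'm) monoid_scheme \<Rightarrow> ('b, 'n) monoid_scheme \<Rightarrow> ('a \<times> 'b) set \<Rightarrow> 'b set" where
  "p2 G H U = {h \<in> carrier H. \<exists>g \<in> carrier G. (g, h) \<in> U}"

definition k1 :: "('a, 'm) monoid_scheme \<Rightarrow> ('b, 'n) monoid_scheme \<Rightarrow> ('a \<times> 'b) set \<Rightarrow> 'a set" where
  "k1 G H U = {g \<in> carrier G. (g, \<one>\<^bsub>H\<^esub>) \<in> U}"

definition k2 :: "('a, 'm) monoid_scheme \<Rightarrow> ('b, 'n) monoid_scheme \<Rightarrow> ('a \<times> 'b) set \<Rightarrow> 'b set" where
  "k2 G H U = {h \<in> carrier H. (\<one>\<^bsub>G\<^esub>, h) \<in> U}"

text \<open>Cosets are right cosets throughout, matching the carrier of \<^const>\<open>FactGroup\<close>; for the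
  normal subgroups considered here they coincide with the left cosets. Since HOL functions are
  total, maps out of a quotient group are made unique by requiring them to be \<^const>\<open>undefined\<close>
  outside its carrier (\<^const>\<open>extensional\<close>).\<close>

definition goursat_eta ::
  "('a, 'm) monoid_scheme \<Rightarrow> ('b, 'n) monoid_scheme \<Rightarrow> ('a \<times> 'b) set \<Rightarrow> 'b set \<Rightarrow> 'a set" where
  "goursat_eta G H U =
     (\<lambda>C \<in> carrier (quot H (p2 G H U) (k2 G H U)).
        THE D. \<exists>(g, h) \<in> U. C = k2 G H U #>\<^bsub>H\<^esub> h \<and> D = k1 G H U #>\<^bsub>G\<^esub> g)"

type_synonym ('a, 'b) quintuple =
  "'a set \<times> 'a set \<times> ('b set \<Rightarrow> 'a set) \<times> 'b set \<times> 'b set"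

definition goursat_quintuples ::
  "('a, 'm) monoid_scheme \<Rightarrow> ('b, 'n) monoid_scheme \<Rightarrow> ('a, 'b) quintuple set" where
  "goursat_quintuples G H =
     {(P, K, \<eta>, L, Q).
        subgroup P G \<and> K \<lhd> G\<lparr>carrier := P\<rparr> \<and>
        subgroup Q H \<and> L \<lhd> H\<lparr>carrier := Q\<rparr> \<and>
        \<eta> \<in> iso (quot H Q L) (quot G P K) \<and>
        \<eta> \<in> extensional (carrier (quot H Q L))}"

definition goursat_correspondent ::
  "('a, 'm) monoid_scheme \<Rightarrow> ('b, 'n) monoid_scheme \<Rightarrow> ('a \<times> 'b) set \<Rightarrow> ('a, 'b) quintuple" where
  "goursat_correspondent G H U =
     (p1 G H U, k1 G H U, goursat_eta G H U, k2 G H U, p2 G H U)"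

definition commutator_subgroup ::
  "('a, 'm) monoid_scheme \<Rightarrow> 'a set \<Rightarrow> 'a set \<Rightarrow> 'a set" where
  "commutator_subgroup G A B =
     generate G (\<Union>a \<in> A. \<Union>b \<in> B. {a \<otimes>\<^bsub>G\<^esub> b \<otimes>\<^bsub>G\<^esub> inv\<^bsub>G\<^esub> a \<otimes>\<^bsub>G\<^esub> inv\<^bsub>G\<^esub> b})"


section \<open>Crossed modules\<close>

record ('a, 'g) xmod =
  top_group :: "'a monoid"
  base_group :: "'g monoid"
  action :: "'g \<Rightarrow> 'a \<Rightarrow> 'a"
  boundary :: "'a \<Rightarrow> 'g"

text \<open>An action by automorphisms is a homomorphism into \<^const>\<open>AutoGroup\<close>.\<close>

definition crossed_module :: "('a, 'g) xmod \<Rightarrow> bool" where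
  "crossed_module X \<longleftrightarrow>
     (let A = top_group X; G = base_group X; act = action X; d = boundary X in
        group A \<and> group G \<and>
        act \<in> hom G (AutoGroup A) \<and>
        d \<in> hom A G \<and>
        (\<forall>g \<in> carrier G. \<forall>a \<in> carrier A. d (act g a) = g \<otimes>\<^bsub>G\<^esub> d a \<otimes>\<^bsub>G\<^esub> inv\<^bsub>G\<^esub> g) \<and>
        (\<forall>a \<in> carrier A. \<forall>b \<in> carrier A. act (d b) a = b \<otimes>\<^bsub>A\<^esub> a \<otimes>\<^bsub>A\<^esub> inv\<^bsub>A\<^esub> b))"

definition xmod_hom ::
  "('a, 'g) xmod \<Rightarrow> ('b, 'h) xmod \<Rightarrow> (('a \<Rightarrow> 'b) \<times> ('g \<Rightarrow> 'h)) set" where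
  "xmod_hom X Y =
     {(\<alpha>, \<beta>).
        \<alpha> \<in> hom (top_group X) (top_group Y) \<and>
        \<beta> \<in> hom (base_group X) (base_group Y) \<and>
        (\<forall>a \<in> carrier (top_group X). boundary Y (\<alpha> a) = \<beta> (boundary X a)) \<and>
        (\<forall>g \<in> carrier (base_group X). \<forall>a \<in> carrier (top_group X).
           \<alpha> (action X g a) = action Y (\<beta> g) (\<alpha> a))}"

definition xmod_iso ::
  "('a, 'g) xmod \<Rightarrow> ('b, 'h) xmod \<Rightarrow> (('a \<Rightarrow> 'b) \<times> ('g \<Rightarrow> 'h)) set" where
  "xmod_iso X Y =
     {(\<alpha>, \<beta>) \<in> xmod_hom X Y.
        \<alpha> \<in> iso (top_group X) (top_group Y) \<and> \<beta> \<in> iso (base_group X) (base_group Y)}"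

text \<open>The crossed module \<open>(P2/K2, P1/K1, \<partial>)\<close> with \<open>\<partial> (x K2) = x K1\<close> and
  the conjugation action \<open>(g K1) (x K2) = (g x g\<inverse>) K2\<close>. The definite descriptions express these
  equations on coset representatives; the lemmas below show that they hold when the maps
  are well defined.\<close>

definition quot_boundary ::
  "('a, 'm) monoid_scheme \<Rightarrow> 'a set \<Rightarrow> 'a set \<Rightarrow> 'a set \<Rightarrow> 'a set \<Rightarrow> 'a set" where
  "quot_boundary G P2 K2 K1 =
     (\<lambda>C. THE D. \<exists>x \<in> P2. C = K2 #>\<^bsub>G\<^esub> x \<and> D = K1 #>\<^bsub>G\<^esub> x)"

definition quot_conj ::
  "('a, 'm) monoid_scheme \<Rightarrow> 'a set \<Rightarrow> 'a set \<Rightarrow> 'a set \<Rightarrow> 'a set \<Rightarrow> 'a set \<Rightarrow> 'a set \<Rightarrow> 'a set" where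
  "quot_conj G P2 K2 P1 K1 =
     (\<lambda>C. \<lambda>D \<in> carrier (quot G P2 K2).
        THE E. \<exists>g \<in> P1. \<exists>x \<in> P2.
          C = K1 #>\<^bsub>G\<^esub> g \<and> D = K2 #>\<^bsub>G\<^esub> x \<and>
          E = K2 #>\<^bsub>G\<^esub> (g \<otimes>\<^bsub>G\<^esub> x \<otimes>\<^bsub>G\<^esub> inv\<^bsub>G\<^esub> g))"

definition quot_xmod ::
  "('a, 'm) monoid_scheme \<Rightarrow> 'a set \<Rightarrow> 'a set \<Rightarrow> 'a set \<Rightarrow> 'a set \<Rightarrow> ('a set, 'a set) xmod" where
  "quot_xmod G P2 K2 P1 K1 =
     \<lparr>top_group = quot G P2 K2,
      base_group = quot G P1 K1,
      action = quot_conj G P2 K2 P1 K1,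
      boundary = quot_boundary G P2 K2 K1\<rparr>"


section \<open>Well-definedness\<close>

lemma (in group) rcos_eq_iff:
  assumes "subgroup K G" "x \<in> carrier G" "y \<in> carrier G"
  shows "K #> x = K #> y \<longleftrightarrow> x \<otimes> inv y \<in> K"
proof
  assume "K #> x = K #> y"
  then have "x \<in> K #> y"
    using rcos_self[OF assms(2,1)] by simp
  then obtain k where k: "k \<in> K" "x = k \<otimes> y"
    by (auto simp: r_coset_def)
  then have "x \<otimes> inv y = k"
    using assms by (simp add: m_assoc subgroup.mem_carrier)
  with k show "x \<otimes> inv y \<in> K" by simp
next
  assume *: "x \<otimes> inv y \<in> K"
  have "x = (x \<otimes> inv y) \<otimes> y"
    using assms by (simp add: m_assoc)
  then have "x \<in> K #> y"
    using * by (auto simp: r_coset_def)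
  then show "K #> x = K #> y"
    using repr_independence[OF _ assms(3,1)] by simp
qed

lemma goursat_eta_rcos:
  assumes "group G" "group H" and U: "subgroup U (G \<times>\<times> H)" and gh: "(g, h) \<in> U"
  shows "goursat_eta G H U (k2 G H U #>\<^bsub>H\<^esub> h) = k1 G H U #>\<^bsub>G\<^esub> g"
proof -
  interpret G: group G by fact
  interpret H: group H by fact
  interpret GH: group "G \<times>\<times> H" using assms by (intro DirProd_group)
  interpret U: subgroup U "G \<times>\<times> H" by fact
  have sub: "x \<in> carrier G \<and> y \<in> carrier H" if "(x, y) \<in> U" for x y
    using that U.subset by auto
  have mult: "(x \<otimes>\<^bsub>G\<^esub> x', y \<otimes>\<^bsub>H\<^esub> y') \<in> U" if "(x, y) \<in> U" "(x', y') \<in> U" for x y x' y'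
    using U.m_closed[OF that] by simp
  have inv: "(inv\<^bsub>G\<^esub> x, inv\<^bsub>H\<^esub> y) \<in> U" if "(x, y) \<in> U" for x y
    using U.m_inv_closed[OF that] sub[OF that] by (simp add: inv_DirProd assms)
  have one: "(\<one>\<^bsub>G\<^esub>, \<one>\<^bsub>H\<^esub>) \<in> U"
    using U.one_closed by simp
  have K: "subgroup (k1 G H U) G"
  proof (rule G.subgroupI)
    show "k1 G H U \<subseteq> carrier G" and "k1 G H U \<noteq> {}"
      using one by (auto simp: k1_def)
    show "inv\<^bsub>G\<^esub> a \<in> k1 G H U" if "a \<in> k1 G H U" for a
      using that inv[of a "\<one>\<^bsub>H\<^esub>"] by (simp add: k1_def)
    show "a \<otimes>\<^bsub>G\<^esub> b \<in> k1 G H U" if "a \<in> k1 G H U" "b \<in> k1 G H U" for a b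
      using that mult[of a "\<one>\<^bsub>H\<^esub>" b "\<one>\<^bsub>H\<^esub>"] by (simp add: k1_def)
  qed
  have L: "subgroup (k2 G H U) H"
  proof (rule H.subgroupI)
    show "k2 G H U \<subseteq> carrier H" and "k2 G H U \<noteq> {}"
      using one by (auto simp: k2_def)
    show "inv\<^bsub>H\<^esub> a \<in> k2 G H U" if "a \<in> k2 G H U" for a
      using that inv[of "\<one>\<^bsub>G\<^esub>" a] by (simp add: k2_def)
    show "a \<otimes>\<^bsub>H\<^esub> b \<in> k2 G H U" if "a \<in> k2 G H U" "b \<in> k2 G H U" for a b
      using that mult[of "\<one>\<^bsub>G\<^esub>" a "\<one>\<^bsub>G\<^esub>" b] by (simp add: k2_def)
  qed
  have uniq: "k1 G H U #>\<^bsub>G\<^esub> x = k1 G H U #>\<^bsub>G\<^esub> g"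
    if xy: "(x, y) \<in> U" and eq: "k2 G H U #>\<^bsub>H\<^esub> h = k2 G H U #>\<^bsub>H\<^esub> y" for x y
  proof -
    have "h \<otimes>\<^bsub>H\<^esub> inv\<^bsub>H\<^esub> y \<in> k2 G H U"
      using eq H.rcos_eq_iff[OF L] sub xy gh by blast
    then have "(\<one>\<^bsub>G\<^esub>, h \<otimes>\<^bsub>H\<^esub> inv\<^bsub>H\<^esub> y) \<in> U"
      by (simp add: k2_def)
    from mult[OF this xy] have "(x, h) \<in> U"
      using sub[OF xy] sub[OF gh] by (simp add: H.m_assoc)
    from mult[OF this inv[OF gh]] have "x \<otimes>\<^bsub>G\<^esub> inv\<^bsub>G\<^esub> g \<in> k1 G H U"
      using sub[OF xy] sub[OF gh] by (simp add: k1_def)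
    then show ?thesis
      using G.rcos_eq_iff[OF K] sub xy gh by blast
  qed
  have "k2 G H U #>\<^bsub>H\<^esub> h \<in> carrier (quot H (p2 G H U) (k2 G H U))"
    using gh sub[OF gh] by (auto simp: carrier_FactGroup p2_def r_coset_def)
  moreover have "(THE D. \<exists>(x, y) \<in> U. k2 G H U #>\<^bsub>H\<^esub> h = k2 G H U #>\<^bsub>H\<^esub> y \<and>
      D = k1 G H U #>\<^bsub>G\<^esub> x) = k1 G H U #>\<^bsub>G\<^esub> g"
    by (rule the_equality) (use gh uniq in blast)+
  ultimately show ?thesis
    by (simp add: goursat_eta_def)
qed

lemma (in group) quot_boundary_rcos:
  assumes "subgroup K2 G" "subgroup K1 G" "K2 \<subseteq> K1" "P2 \<subseteq> carrier G" "x \<in> P2"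
  shows "quot_boundary G P2 K2 K1 (K2 #> x) = K1 #> x"
  unfolding quot_boundary_def
proof (rule the_equality)
  fix D assume "\<exists>y\<in>P2. K2 #> x = K2 #> y \<and> D = K1 #> y"
  then obtain y where y: "y \<in> P2" "K2 #> x = K2 #> y" "D = K1 #> y" by blast
  then have "x \<otimes> inv y \<in> K1"
    using rcos_eq_iff[of K2 x y] assms by blast
  then show "D = K1 #> x"
    using rcos_eq_iff[of K1 x y] y assms by blast
qed (use assms in blast)

lemma (in group) quot_conj_rcos:
  assumes P1: "subgroup P1 G" and P2: "subgroup P2 G" and K1: "subgroup K1 G"
    and P2P1: "P2 \<subseteq> P1"
    and norm: "K2 \<lhd> G\<lparr>carrier := P1\<rparr>"
    and comm: "commutator_subgroup G K1 P2 \<subseteq> K2"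
    and normP: "P2 \<lhd> G\<lparr>carrier := P1\<rparr>"
    and g: "g \<in> P1" and x: "x \<in> P2"
  shows "quot_conj G P2 K2 P1 K1 (K1 #> g) (K2 #> x) = K2 #> (g \<otimes> x \<otimes> inv g)"
proof -
  have K2: "subgroup K2 G"
    using norm P1 incl_subgroup normal_imp_subgroup by blast
  have sub[simp]: "a \<in> carrier G" if "a \<in> P1" for a
    using that P1 by (rule subgroup.mem_carrier[rotated])
  have conjK: "a \<otimes> k \<otimes> inv a \<in> K2" if "a \<in> P1" "k \<in> K2" for a k
    using normal.inv_op_closed2[OF norm, of a k] that m_inv_consistent[OF P1, of a] by simp
  have conjP: "a \<otimes> k \<otimes> inv a \<in> P2" if "a \<in> P1" "k \<in> P2" for a k
    using normal.inv_op_closed2[OF normP, of a k] that m_inv_consistent[OF P1, of a] by simp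
  have com: "k \<otimes> p \<otimes> inv k \<otimes> inv p \<in> K2" if "k \<in> K1" "p \<in> P2" for k p
  proof -
    have "k \<otimes> p \<otimes> inv k \<otimes> inv p \<in> commutator_subgroup G K1 P2"
      unfolding commutator_subgroup_def by (rule generate.incl) (use that in blast)
    with comm show ?thesis by blast
  qed
  have conj_diff: "a \<otimes> b \<otimes> inv a \<otimes> inv (a \<otimes> c \<otimes> inv a) = a \<otimes> (b \<otimes> inv c) \<otimes> inv a"
    if "a \<in> carrier G" "b \<in> carrier G" "c \<in> carrier G" for a b c
  proof -
    have "inv a \<otimes> (a \<otimes> (inv c \<otimes> inv a)) = inv c \<otimes> inv a"
      using that by (simp flip: m_assoc)
    then show ?thesis
      using that by (simp add: m_assoc inv_mult_group)
  qed
  have uniq: "K2 #> (g' \<otimes> x' \<otimes> inv g') = K2 #> (g \<otimes> x \<otimes> inv g)"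
    if g': "g' \<in> P1" and x': "x' \<in> P2" and eg: "K1 #> g = K1 #> g'" and ex: "K2 #> x = K2 #> x'"
    for g' x'
  proof -
    have c: "g' \<in> carrier G" "x' \<in> carrier G" "g \<in> carrier G" "x \<in> carrier G"
      using g g' x x' P2P1 by auto
    define k where "k = g' \<otimes> inv g"
    have k: "k \<in> K1"
      unfolding k_def using rcos_eq_iff[OF K1, of g' g] eg c by simp
    have kc: "k \<in> carrier G" using c by (simp add: k_def)
    define p where "p = g \<otimes> x' \<otimes> inv g"
    have p: "p \<in> P2" unfolding p_def by (rule conjP[OF g x'])
    have pc: "p \<in> carrier G" using c by (simp add: p_def)
    have "g' = k \<otimes> g" using c by (simp add: k_def m_assoc)
    then have "g' \<otimes> x' \<otimes> inv g' = k \<otimes> p \<otimes> inv k"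
      using c kc by (simp add: p_def m_assoc inv_mult_group)
    then have 1: "K2 #> (g' \<otimes> x' \<otimes> inv g') = K2 #> p"
      using rcos_eq_iff[OF K2, of "k \<otimes> p \<otimes> inv k" p] com[OF k p] kc pc by simp
    have "x' \<otimes> inv x \<in> K2"
      using rcos_eq_iff[OF K2, of x' x] ex c by simp
    from conjK[OF g this] have "p \<otimes> inv (g \<otimes> x \<otimes> inv g) \<in> K2"
      using c by (simp add: p_def conj_diff)
    then have "K2 #> p = K2 #> (g \<otimes> x \<otimes> inv g)"
      using rcos_eq_iff[OF K2, of p "g \<otimes> x \<otimes> inv g"] c pc by simp
    with 1 show ?thesis by simp
  qed
  have "K2 #> x \<in> carrier (quot G P2 K2)"
    using x by (auto simp: carrier_FactGroup r_coset_def)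
  moreover have "(THE E. \<exists>g'\<in>P1. \<exists>x'\<in>P2. K1 #> g = K1 #> g' \<and> K2 #> x = K2 #> x' \<and>
      E = K2 #> (g' \<otimes> x' \<otimes> inv g')) = K2 #> (g \<otimes> x \<otimes> inv g)"
    by (rule the_equality) (use g x uniq in blast)+
  ultimately show ?thesis
    by (simp add: quot_conj_def)
qed

end

theory Submission
  imports Defs
begin

text \<open>A subgroup \<open>U\<close> of \<open>G \<times> H\<close> is the same thing as its Goursat correspondent: \<open>U\<close> is the
  pullback to \<open>P \<times> Q\<close> of the graph of \<open>\<eta>\<close>, that is, \<open>(g, h) \<in> U\<close> iff \<open>g \<in> P\<close>, \<open>h \<in> Q\<close> and
  \<open>\<eta> (L h) = K g\<close> (\<open>goursat_bij\<close>). So it remains to recognize, from the correspondents of two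
  subgroups \<open>T\<close> and \<open>S\<close>, whether \<open>S\<close> is normal in \<open>T\<close>.

  If it is, projecting to \<open>G\<close> and intersecting with \<open>G \<times> 1\<close> gives the inclusions and
  normality conditions, and the commutator of \<open>(k, 1) \<in> T\<close> with \<open>(p, q) \<in> S\<close> is
  \<open>([k, p], 1) \<in> S\<close>, which gives \<open>[K1, P2] \<subseteq> K2\<close>. These conditions make
  \<open>P2/K2 \<rightarrow> P1/K1\<close>, with conjugation, a crossed module; the same holds in \<open>H\<close>.

  Once the two crossed modules exist, the two requirements on \<open>(\<eta>2, \<eta>1)\<close> for being a morphism
  translate separately, by the pullback description of \<open>T\<close> and \<open>S\<close>: compatibility with the
  boundary maps says that \<open>S \<subseteq> T\<close>, and equivariance says that \<open>S\<close> is closed under conjugation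
  by \<open>T\<close> (\<open>normal_iff_xmod_iso\<close>). Bijectivity of \<open>\<eta>1\<close> and \<open>\<eta>2\<close> is already part of Goursat's
  correspondence.\<close>

section \<open>Quotients of subgroups\<close>

context group
begin

lemma normal_in_subgroup_iff:
  assumes P: "subgroup P G"
  shows "N \<lhd> G\<lparr>carrier := P\<rparr> \<longleftrightarrow>
    subgroup N G \<and> N \<subseteq> P \<and> (\<forall>g\<in>P. \<forall>x\<in>N. g \<otimes> x \<otimes> inv g \<in> N)"
proof -
  interpret P: group "G\<lparr>carrier := P\<rparr>"
    by (rule subgroup_imp_group[OF P])
  have "subgroup N (G\<lparr>carrier := P\<rparr>) \<longleftrightarrow> subgroup N G \<and> N \<subseteq> P"
    using subgroup_incl[OF _ P] incl_subgroup[OF P]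
      subgroup.subset[of N "G\<lparr>carrier := P\<rparr>"] by auto
  then show ?thesis
    using m_inv_consistent[OF P] by (auto simp: P.normal_inv_iff)
qed

lemma carrier_quot: "carrier (quot G P K) = (\<lambda>x. K #> x) ` P"
  by (simp add: carrier_FactGroup r_coset_def)

context
  fixes P K
  assumes P: "subgroup P G" and K: "K \<lhd> G\<lparr>carrier := P\<rparr>"
begin

lemma group_quot: "group (quot G P K)"
  using normal.factorgroup_is_group[OF K] .

lemma quot_eq_iff:
  assumes "x \<in> P" "y \<in> P"
  shows "K #> x = K #> y \<longleftrightarrow> x \<otimes> inv y \<in> K"
  using rcos_eq_iff[of K x y] K assms subgroup.mem_carrier[OF P]
  by (simp add: normal_in_subgroup_iff[OF P])

lemma quot_mult:
  assumes "x \<in> P" "y \<in> P"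
  shows "(K #> x) \<otimes>\<^bsub>quot G P K\<^esub> (K #> y) = K #> (x \<otimes> y)"
  using normal.rcos_sum[OF K] assms by (simp add: r_coset_def)

lemma quot_one: "\<one>\<^bsub>quot G P K\<^esub> = K #> \<one>"
  using K by (simp add: normal_in_subgroup_iff[OF P] coset_mult_one subgroup.subset)

lemma quot_inv:
  assumes "x \<in> P"
  shows "inv\<^bsub>quot G P K\<^esub> (K #> x) = K #> inv x"
proof (rule group.inv_equality[OF group_quot])
  show "(K #> inv x) \<otimes>\<^bsub>quot G P K\<^esub> (K #> x) = \<one>\<^bsub>quot G P K\<^esub>"
    using assms P by (simp only: quot_mult quot_one subgroup.m_inv_closed
        subgroup.mem_carrier l_inv)
qed (use assms P in \<open>auto simp: carrier_quot intro: subgroup.m_inv_closed\<close>)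

end

end


section \<open>Goursat's correspondence\<close>

locale goursat_subgroup = G: group G + H: group H + U: subgroup U "G \<times>\<times> H"
  for G :: "('a, 'm) monoid_scheme" and H :: "('b, 'n) monoid_scheme" and U
begin

abbreviation "P \<equiv> p1 G H U"
abbreviation "K \<equiv> k1 G H U"
abbreviation "\<eta> \<equiv> goursat_eta G H U"
abbreviation "L \<equiv> k2 G H U"
abbreviation "Q \<equiv> p2 G H U"

lemma mem_carrier:
  assumes "(g, h) \<in> U"
  shows "g \<in> carrier G" "h \<in> carrier H"
  using U.subset assms by auto

lemma mult_mem: "(g, h) \<in> U \<Longrightarrow> (g', h') \<in> U \<Longrightarrow> (g \<otimes>\<^bsub>G\<^esub> g', h \<otimes>\<^bsub>H\<^esub> h') \<in> U"
  using U.m_closed[of "(g, h)" "(g', h')"] by simp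

lemma inv_mem: "(g, h) \<in> U \<Longrightarrow> (inv\<^bsub>G\<^esub> g, inv\<^bsub>H\<^esub> h) \<in> U"
  using U.m_inv_closed[of "(g, h)"] mem_carrier[of g h]
  by (simp add: inv_DirProd[OF G.group_axioms H.group_axioms])

lemma one_mem: "(\<one>\<^bsub>G\<^esub>, \<one>\<^bsub>H\<^esub>) \<in> U"
  using U.one_closed by simp

lemma mem_P_iff: "g \<in> P \<longleftrightarrow> (\<exists>h. (g, h) \<in> U)"
  unfolding p1_def using mem_carrier by blast

lemma mem_Q_iff: "h \<in> Q \<longleftrightarrow> (\<exists>g. (g, h) \<in> U)"
  unfolding p2_def using mem_carrier by blast

lemma mem_K_iff: "g \<in> K \<longleftrightarrow> (g, \<one>\<^bsub>H\<^esub>) \<in> U"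
  unfolding k1_def using mem_carrier by blast

lemma mem_L_iff: "h \<in> L \<longleftrightarrow> (\<one>\<^bsub>G\<^esub>, h) \<in> U"
  unfolding k2_def using mem_carrier by blast

text \<open>Interchanging the two factors lets every fact about \<open>P\<close> and \<open>K\<close> be reused for \<open>Q\<close>
  and \<open>L\<close>.\<close>

lemma goursat_subgroup_converse: "goursat_subgroup H G (U\<inverse>)"
proof -
  interpret HG: group "H \<times>\<times> G"
    by (intro DirProd_group H.group_axioms G.group_axioms)
  have "subgroup (U\<inverse>) (H \<times>\<times> G)"
    by (rule HG.subgroupI)
      (use one_mem mem_carrier inv_mem mult_mem in
        \<open>auto simp: inv_DirProd[OF H.group_axioms G.group_axioms]\<close>)
  then show ?thesis
    by (intro goursat_subgroup.intro G.group_axioms H.group_axioms)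
qed

lemma converse_eqs: "p1 H G (U\<inverse>) = Q" "k1 H G (U\<inverse>) = L"
  by (simp_all add: p1_def p2_def k1_def k2_def)

lemma subgroup_P: "subgroup P G"
proof (rule G.subgroupI)
  show "P \<subseteq> carrier G" by (auto simp: p1_def)
  show "P \<noteq> {}" using one_mem mem_P_iff by blast
  show "inv\<^bsub>G\<^esub> a \<in> P" if "a \<in> P" for a
    using that inv_mem unfolding mem_P_iff by blast
  show "a \<otimes>\<^bsub>G\<^esub> b \<in> P" if "a \<in> P" "b \<in> P" for a b
    using that mult_mem unfolding mem_P_iff by blast
qed

lemma subgroup_K: "subgroup K G"
proof (rule G.subgroupI)
  show "K \<subseteq> carrier G" by (auto simp: k1_def)
  show "K \<noteq> {}" using one_mem mem_K_iff by blast
  show "inv\<^bsub>G\<^esub> a \<in> K" if "a \<in> K" for a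
    using that inv_mem[of a "\<one>\<^bsub>H\<^esub>"] by (simp add: mem_K_iff)
  show "a \<otimes>\<^bsub>G\<^esub> b \<in> K" if "a \<in> K" "b \<in> K" for a b
    using that mult_mem[of a "\<one>\<^bsub>H\<^esub>" b "\<one>\<^bsub>H\<^esub>"] by (simp add: mem_K_iff)
qed

lemma normal_K: "K \<lhd> G\<lparr>carrier := P\<rparr>"
  unfolding G.normal_in_subgroup_iff[OF subgroup_P]
proof (intro conjI ballI)
  show "K \<subseteq> P" by (auto simp: mem_K_iff mem_P_iff)
  fix g x assume "g \<in> P" "x \<in> K"
  then obtain h where gh: "(g, h) \<in> U" and x: "(x, \<one>\<^bsub>H\<^esub>) \<in> U"
    by (auto simp: mem_P_iff mem_K_iff)
  then show "g \<otimes>\<^bsub>G\<^esub> x \<otimes>\<^bsub>G\<^esub> inv\<^bsub>G\<^esub> g \<in> K"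
    using mult_mem[OF mult_mem[OF gh x] inv_mem[OF gh]] mem_carrier[OF gh]
    by (simp add: mem_K_iff)
qed (rule subgroup_K)

lemma subgroup_Q: "subgroup Q H" and normal_L: "L \<lhd> H\<lparr>carrier := Q\<rparr>"
  using goursat_subgroup.subgroup_P[OF goursat_subgroup_converse]
    goursat_subgroup.normal_K[OF goursat_subgroup_converse]
  by (simp_all only: converse_eqs)

lemma eta_rcos: "(g, h) \<in> U \<Longrightarrow> \<eta> (L #>\<^bsub>H\<^esub> h) = K #>\<^bsub>G\<^esub> g"
  using goursat_eta_rcos[OF G.group_axioms H.group_axioms U.subgroup_axioms] .

text \<open>A subgroup is recovered from its correspondent: if \<open>\<eta>\<close> matches the cosets of \<open>h\<close>
  and \<open>g\<close>, then some \<open>(g', h) \<in> U\<close> has \<open>g' \<in> K g\<close>, so \<open>(g, h)\<close> differs from \<open>(g', h)\<close>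
  only by an element of \<open>K \<times> 1 \<subseteq> U\<close>.\<close>

lemma mem_iff_eta:
  "(g, h) \<in> U \<longleftrightarrow> g \<in> P \<and> h \<in> Q \<and> \<eta> (L #>\<^bsub>H\<^esub> h) = K #>\<^bsub>G\<^esub> g"
proof
  assume "g \<in> P \<and> h \<in> Q \<and> \<eta> (L #>\<^bsub>H\<^esub> h) = K #>\<^bsub>G\<^esub> g"
  then have g: "g \<in> P" and "h \<in> Q" and eta: "\<eta> (L #>\<^bsub>H\<^esub> h) = K #>\<^bsub>G\<^esub> g"
    by auto
  then obtain g' where g': "(g', h) \<in> U"
    by (auto simp: mem_Q_iff)
  then have "K #>\<^bsub>G\<^esub> g = K #>\<^bsub>G\<^esub> g'"
    using eta eta_rcos by simp
  then have "(g \<otimes>\<^bsub>G\<^esub> inv\<^bsub>G\<^esub> g', \<one>\<^bsub>H\<^esub>) \<in> U"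
    using G.quot_eq_iff[OF subgroup_P normal_K g, of g'] g' mem_P_iff mem_K_iff by blast
  from mult_mem[OF this g'] show "(g, h) \<in> U"
    using mem_carrier[OF g'] g subgroup.mem_carrier[OF subgroup_P] by (simp add: G.m_assoc)
qed (use eta_rcos mem_P_iff mem_Q_iff in blast)

text \<open>Every coset in \<open>Q/L\<close> is \<open>L h\<close> for some \<open>(g, h) \<in> U\<close>, and then \<open>\<eta> (L h) = K g\<close>, so each
  property of \<open>\<eta>\<close> is a closure property of \<open>U\<close>. For injectivity: if \<open>\<eta>\<close> sends \<open>L h\<close> and \<open>L h'\<close>
  to the same coset \<open>K g\<close>, then \<open>(g, h), (g, h') \<in> U\<close>, whose quotient is \<open>(1, h h'\<inverse>)\<close>.\<close>

lemma eta_iso: "\<eta> \<in> iso (quot H Q L) (quot G P K)"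
proof -
  have "\<eta> \<in> hom (quot H Q L) (quot G P K)"
  proof (rule homI)
    fix C assume "C \<in> carrier (quot H Q L)"
    then obtain g h where "(g, h) \<in> U" "C = L #>\<^bsub>H\<^esub> h"
      by (auto simp: H.carrier_quot mem_Q_iff)
    then show "\<eta> C \<in> carrier (quot G P K)"
      using mem_P_iff by (auto simp: eta_rcos G.carrier_quot)
  next
    fix C D assume "C \<in> carrier (quot H Q L)" "D \<in> carrier (quot H Q L)"
    then obtain g h g' h' where *: "(g, h) \<in> U" "C = L #>\<^bsub>H\<^esub> h" "(g', h') \<in> U" "D = L #>\<^bsub>H\<^esub> h'"
      by (auto simp: H.carrier_quot mem_Q_iff)
    then have "g \<in> P" "g' \<in> P" "h \<in> Q" "h' \<in> Q"
      by (auto simp: mem_P_iff mem_Q_iff)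
    with * show "\<eta> (C \<otimes>\<^bsub>quot H Q L\<^esub> D) = \<eta> C \<otimes>\<^bsub>quot G P K\<^esub> \<eta> D"
      by (simp add: H.quot_mult[OF subgroup_Q normal_L] G.quot_mult[OF subgroup_P normal_K]
          eta_rcos mult_mem del: mult_FactGroup)
  qed
  moreover have "inj_on \<eta> (carrier (quot H Q L))"
  proof (rule inj_onI)
    fix C D assume "C \<in> carrier (quot H Q L)" "D \<in> carrier (quot H Q L)" and eq: "\<eta> C = \<eta> D"
    then obtain g h g' h' where *: "(g, h) \<in> U" "C = L #>\<^bsub>H\<^esub> h" "(g', h') \<in> U" "D = L #>\<^bsub>H\<^esub> h'"
      by (auto simp: H.carrier_quot mem_Q_iff)
    then have Q: "h \<in> Q" "h' \<in> Q" and P: "g \<in> P" by (auto simp: mem_P_iff mem_Q_iff)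
    have "(g, h') \<in> U"
      using * eq P Q by (simp add: mem_iff_eta)
    from mult_mem[OF \<open>(g, h) \<in> U\<close> inv_mem[OF this]]
    have "h \<otimes>\<^bsub>H\<^esub> inv\<^bsub>H\<^esub> h' \<in> L"
      using mem_carrier[OF *(1)] by (simp add: mem_L_iff)
    with * Q show "C = D"
      using H.quot_eq_iff[OF subgroup_Q normal_L] by simp
  qed
  moreover have "\<eta> ` carrier (quot H Q L) = carrier (quot G P K)"
  proof -
    have "carrier (quot G P K) \<subseteq> \<eta> ` carrier (quot H Q L)"
    proof
      fix D assume "D \<in> carrier (quot G P K)"
      then obtain g h where *: "(g, h) \<in> U" "D = K #>\<^bsub>G\<^esub> g"
        by (auto simp: G.carrier_quot mem_P_iff)
      then have "h \<in> Q"
        using mem_Q_iff by blast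
      with * have "D = \<eta> (L #>\<^bsub>H\<^esub> h)" "L #>\<^bsub>H\<^esub> h \<in> carrier (quot H Q L)"
        by (simp_all add: eta_rcos H.carrier_quot)
      then show "D \<in> \<eta> ` carrier (quot H Q L)"
        by (rule image_eqI)
    qed
    then show ?thesis
      using hom_carrier[OF \<open>\<eta> \<in> hom _ _\<close>] by blast
  qed
  ultimately show ?thesis
    by (simp add: iso_def bij_betw_def)
qed

lemma correspondent_in_quintuples: "goursat_correspondent G H U \<in> goursat_quintuples G H"
  using subgroup_P normal_K subgroup_Q normal_L eta_iso
  by (simp add: goursat_correspondent_def goursat_quintuples_def goursat_eta_def)

end

locale goursat_quintuple = G: group G + H: group H
  for G :: "('a, 'm) monoid_scheme" and H :: "('b, 'n) monoid_scheme" and P K \<eta> L Q +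
  assumes quintuple: "(P, K, \<eta>, L, Q) \<in> goursat_quintuples G H"
begin

text \<open>The graph of \<open>\<eta>\<close>, pulled back along the projections \<open>Q \<rightarrow> Q/L\<close> and \<open>P \<rightarrow> P/K\<close>. By
  \<open>goursat_subgroup.mem_iff_eta\<close>, no other subgroup can have this quintuple as its
  correspondent.\<close>

definition pullback :: "('a \<times> 'b) set" where
  "pullback = {(g, h). g \<in> P \<and> h \<in> Q \<and> \<eta> (L #>\<^bsub>H\<^esub> h) = K #>\<^bsub>G\<^esub> g}"

lemma mem_pullback_iff:
  "(g, h) \<in> pullback \<longleftrightarrow> g \<in> P \<and> h \<in> Q \<and> \<eta> (L #>\<^bsub>H\<^esub> h) = K #>\<^bsub>G\<^esub> g"
  by (simp add: pullback_def)

lemma P: "subgroup P G" and K: "K \<lhd> G\<lparr>carrier := P\<rparr>"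
  and Q: "subgroup Q H" and L: "L \<lhd> H\<lparr>carrier := Q\<rparr>"
  and hom: "\<eta> \<in> hom (quot H Q L) (quot G P K)"
  and bij: "bij_betw \<eta> (carrier (quot H Q L)) (carrier (quot G P K))"
  and ext: "\<eta> \<in> extensional (carrier (quot H Q L))"
  using quintuple by (auto simp: goursat_quintuples_def iso_def)

lemma group_hom_eta: "group_hom (quot H Q L) (quot G P K) \<eta>"
  using hom G.group_quot[OF P K] H.group_quot[OF Q L]
  by (simp add: group_hom_def group_hom_axioms_def)

lemma subgroup_pullback: "subgroup pullback (G \<times>\<times> H)"
proof -
  interpret GH: group "G \<times>\<times> H"
    by (intro DirProd_group H.group_axioms G.group_axioms)
  interpret eta: group_hom "quot H Q L" "quot G P K" \<eta>
    by (rule group_hom_eta)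
  have cl: "(L #>\<^bsub>H\<^esub> h) \<in> carrier (quot H Q L)" if "h \<in> Q" for h
    using that by (simp add: H.carrier_quot)
  note [simp del] = mult_FactGroup one_FactGroup
  show ?thesis
  proof (rule GH.subgroupI)
    show "pullback \<subseteq> carrier (G \<times>\<times> H)"
      using subgroup.subset[OF P] subgroup.subset[OF Q] by (auto simp: pullback_def)
    show "pullback \<noteq> {}"
      using eta.hom_one subgroup.one_closed[OF P] subgroup.one_closed[OF Q]
      by (auto simp: pullback_def G.quot_one[OF P K] H.quot_one[OF Q L])
  next
    fix a assume "a \<in> pullback"
    then obtain g h where a: "a = (g, h)" "g \<in> P" "h \<in> Q" "\<eta> (L #>\<^bsub>H\<^esub> h) = K #>\<^bsub>G\<^esub> g"
      by (auto simp: pullback_def)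
    then show "inv\<^bsub>G \<times>\<times> H\<^esub> a \<in> pullback"
      using eta.hom_inv[OF cl[of h]] P Q
      by (simp add: pullback_def G.quot_inv[OF P K] H.quot_inv[OF Q L] subgroup.mem_carrier
          subgroup.m_inv_closed inv_DirProd[OF G.group_axioms H.group_axioms])
  next
    fix a b assume "a \<in> pullback" "b \<in> pullback"
    then obtain g h g' h' where
      a: "a = (g, h)" "g \<in> P" "h \<in> Q" "\<eta> (L #>\<^bsub>H\<^esub> h) = K #>\<^bsub>G\<^esub> g" and
      b: "b = (g', h')" "g' \<in> P" "h' \<in> Q" "\<eta> (L #>\<^bsub>H\<^esub> h') = K #>\<^bsub>G\<^esub> g'"
      by (auto simp: pullback_def)
    then show "a \<otimes>\<^bsub>G \<times>\<times> H\<^esub> b \<in> pullback"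
      using eta.hom_mult[OF cl[of h] cl[of h']] P Q
      by (simp add: pullback_def G.quot_mult[OF P K] H.quot_mult[OF Q L] subgroup.m_closed)
  qed
qed

sublocale U: goursat_subgroup G H pullback
  by (intro goursat_subgroup.intro G.group_axioms H.group_axioms subgroup_pullback)

text \<open>The projections are onto since \<open>\<eta>\<close> is onto, and the kernels are \<open>K\<close> and \<open>L\<close> since
  \<open>\<eta>\<close> preserves the identity and is injective.\<close>

lemma correspondent_pullback: "goursat_correspondent G H pullback = (P, K, \<eta>, L, Q)"
proof -
  interpret eta: group_hom "quot H Q L" "quot G P K" \<eta>
    by (rule group_hom_eta)
  have eta_one: "\<eta> (L #>\<^bsub>H\<^esub> \<one>\<^bsub>H\<^esub>) = K #>\<^bsub>G\<^esub> \<one>\<^bsub>G\<^esub>"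
    using eta.hom_one unfolding G.quot_one[OF P K] H.quot_one[OF Q L] .
  have KP: "K \<subseteq> P" and LQ: "L \<subseteq> Q"
    using K L by (auto simp: G.normal_in_subgroup_iff[OF P] H.normal_in_subgroup_iff[OF Q])
  have P_eq: "U.P = P"
  proof -
    have "\<exists>h. (g, h) \<in> pullback" if "g \<in> P" for g
    proof -
      have "K #>\<^bsub>G\<^esub> g \<in> \<eta> ` carrier (quot H Q L)"
        using bij that by (simp add: bij_betw_def G.carrier_quot)
      then show ?thesis
        using that by (auto simp: mem_pullback_iff H.carrier_quot)
    qed
    then show ?thesis
      by (auto simp: U.mem_P_iff mem_pullback_iff)
  qed
  have Q_eq: "U.Q = Q"
  proof -
    have "\<exists>g. (g, h) \<in> pullback" if "h \<in> Q" for h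
    proof -
      have "\<eta> (L #>\<^bsub>H\<^esub> h) \<in> carrier (quot G P K)"
        using that by (intro eta.hom_closed) (simp add: H.carrier_quot)
      then show ?thesis
        using that by (auto simp: mem_pullback_iff G.carrier_quot)
    qed
    then show ?thesis
      by (auto simp: U.mem_Q_iff mem_pullback_iff)
  qed
  have K_eq: "U.K = K"
  proof -
    have "g \<in> U.K \<longleftrightarrow> g \<in> K" if "g \<in> P" for g
      using that G.quot_eq_iff[OF P K that, of "\<one>\<^bsub>G\<^esub>"] subgroup.one_closed[OF P]
        subgroup.one_closed[OF Q] subgroup.mem_carrier[OF P]
      by (auto simp: U.mem_K_iff mem_pullback_iff eta_one)
    then show ?thesis
      using KP U.mem_K_iff mem_pullback_iff by blast
  qed
  have L_eq: "U.L = L"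
  proof -
    have "h \<in> U.L \<longleftrightarrow> h \<in> L" if "h \<in> Q" for h
    proof -
      have "h \<in> U.L \<longleftrightarrow> \<eta> (L #>\<^bsub>H\<^esub> h) = \<eta> (L #>\<^bsub>H\<^esub> \<one>\<^bsub>H\<^esub>)"
        using that subgroup.one_closed[OF P] by (auto simp: U.mem_L_iff mem_pullback_iff eta_one)
      also have "\<dots> \<longleftrightarrow> L #>\<^bsub>H\<^esub> h = L #>\<^bsub>H\<^esub> \<one>\<^bsub>H\<^esub>"
        using bij that subgroup.one_closed[OF Q]
        by (intro inj_on_eq_iff[of \<eta> "carrier (quot H Q L)"])
          (auto simp: bij_betw_def H.carrier_quot)
      also have "\<dots> \<longleftrightarrow> h \<in> L"
        using that H.quot_eq_iff[OF Q L that, of "\<one>\<^bsub>H\<^esub>"] subgroup.one_closed[OF Q]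
          subgroup.mem_carrier[OF Q] by simp
      finally show ?thesis .
    qed
    then show ?thesis
      using LQ U.mem_L_iff mem_pullback_iff by blast
  qed
  have eta_eq: "U.\<eta> = \<eta>"
  proof (rule extensionalityI[OF _ ext])
    show "U.\<eta> \<in> extensional (carrier (quot H Q L))"
      by (simp add: goursat_eta_def L_eq Q_eq)
    fix C assume "C \<in> carrier (quot H Q L)"
    then obtain h where h: "h \<in> Q" "C = L #>\<^bsub>H\<^esub> h"
      by (auto simp: H.carrier_quot)
    then obtain g where "(g, h) \<in> pullback"
      using Q_eq U.mem_Q_iff by blast
    then show "U.\<eta> C = \<eta> C"
      using U.eta_rcos[of g h] h by (simp add: K_eq L_eq) (simp add: mem_pullback_iff)
  qed
  show ?thesis
    by (simp add: goursat_correspondent_def P_eq K_eq eta_eq L_eq Q_eq)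
qed

end

text \<open>Goursat's lemma: injectivity holds because \<open>U\<close> can be read off its correspondent, and
  pullbacks provide the preimages.\<close>

theorem goursat_bij:
  assumes "group G" "group H"
  shows "bij_betw (goursat_correspondent G H) {U. subgroup U (G \<times>\<times> H)} (goursat_quintuples G H)"
proof (rule bij_betw_imageI)
  interpret G: group G by fact
  interpret H: group H by fact
  have sub: "goursat_subgroup G H U" if "subgroup U (G \<times>\<times> H)" for U
    using assms that by (simp add: goursat_subgroup_def)
  show "inj_on (goursat_correspondent G H) {U. subgroup U (G \<times>\<times> H)}"
  proof (rule inj_onI)
    fix U V assume "U \<in> {U. subgroup U (G \<times>\<times> H)}" "V \<in> {U. subgroup U (G \<times>\<times> H)}"
      and eq: "goursat_correspondent G H U = goursat_correspondent G H V"
    then interpret U: goursat_subgroup G H U + V: goursat_subgroup G H V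
      using sub by auto
    have "(g, h) \<in> U \<longleftrightarrow> (g, h) \<in> V" for g h
      using eq by (simp add: U.mem_iff_eta V.mem_iff_eta goursat_correspondent_def)
    then show "U = V" by auto
  qed
  show "goursat_correspondent G H ` {U. subgroup U (G \<times>\<times> H)} = goursat_quintuples G H"
  proof
    show "goursat_correspondent G H ` {U. subgroup U (G \<times>\<times> H)} \<subseteq> goursat_quintuples G H"
      using sub goursat_subgroup.correspondent_in_quintuples by blast
    show "goursat_quintuples G H \<subseteq> goursat_correspondent G H ` {U. subgroup U (G \<times>\<times> H)}"
    proof
      fix q assume q: "q \<in> goursat_quintuples G H"
      obtain P K \<eta> L Q where q_eq: "q = (P, K, \<eta>, L, Q)" by (rule prod_cases5)
      interpret goursat_quintuple G H P K \<eta> L Q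
        using q by unfold_locales (simp add: q_eq)
      show "q \<in> goursat_correspondent G H ` {U. subgroup U (G \<times>\<times> H)}"
        using correspondent_pullback subgroup_pullback q_eq by (metis image_eqI mem_Collect_eq)
    qed
  qed
qed


section \<open>Crossed modules from sections\<close>

text \<open>For sections \<open>(P1, K1)\<close> and \<open>(P2, K2)\<close>, these conditions make the conjugation action of
  \<open>P1/K1\<close> on \<open>P2/K2\<close> and the boundary map \<open>P2/K2 \<rightarrow> P1/K1\<close> well defined: \<open>P1\<close> acts on \<open>P2/K2\<close>
  because \<open>K2\<close> and \<open>P2\<close> are normal in it, and the action of \<open>K1\<close> is trivial because of
  \<open>[K1, P2] \<subseteq> K2\<close>.\<close>

definition crossed_sections ::
  "('a, 'm) monoid_scheme \<Rightarrow> 'a set \<Rightarrow> 'a set \<Rightarrow> 'a set \<Rightarrow> 'a set \<Rightarrow> bool" where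
  "crossed_sections G P1 K1 P2 K2 \<longleftrightarrow>
     K2 \<lhd> G\<lparr>carrier := K1\<rparr> \<and> K2 \<lhd> G\<lparr>carrier := P1\<rparr> \<and> P2 \<lhd> G\<lparr>carrier := P1\<rparr> \<and>
     commutator_subgroup G K1 P2 \<subseteq> K2"

lemma (in group) commutator_subgroup_subset:
  assumes "subgroup K G" and "\<And>a b. a \<in> A \<Longrightarrow> b \<in> B \<Longrightarrow> a \<otimes> b \<otimes> inv a \<otimes> inv b \<in> K"
  shows "commutator_subgroup G A B \<subseteq> K"
  unfolding commutator_subgroup_def
  by (rule generate_subgroup_incl) (use assms in auto)

lemma (in group) conj_mult:
  assumes "g \<in> carrier G" "x \<in> carrier G" "y \<in> carrier G"
  shows "g \<otimes> (x \<otimes> y) \<otimes> inv g = (g \<otimes> x \<otimes> inv g) \<otimes> (g \<otimes> y \<otimes> inv g)"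
proof -
  have "inv g \<otimes> (g \<otimes> (y \<otimes> inv g)) = y \<otimes> inv g"
    using assms by (simp flip: m_assoc)
  then show ?thesis
    using assms by (simp add: m_assoc)
qed

lemma (in group) conj_inv_cancel:
  assumes "g \<in> carrier G" "x \<in> carrier G"
  shows "inv g \<otimes> (g \<otimes> x \<otimes> inv g) \<otimes> g = x"
proof -
  have "inv g \<otimes> (g \<otimes> x) = x"
    using assms by (simp flip: m_assoc)
  then show ?thesis
    using assms by (simp add: m_assoc)
qed

locale crossed_section_pair = group G for G :: "('a, 'm) monoid_scheme" (structure) +
  fixes P1 K1 P2 K2
  assumes P1: "subgroup P1 G" and K1: "K1 \<lhd> G\<lparr>carrier := P1\<rparr>"
    and P2: "subgroup P2 G" and K2: "K2 \<lhd> G\<lparr>carrier := P2\<rparr>"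
    and sections: "crossed_sections G P1 K1 P2 K2"
begin

lemma subgroups: "subgroup K1 G" "subgroup K2 G"
  using K1 K2 by (auto simp: normal_in_subgroup_iff[OF P1] normal_in_subgroup_iff[OF P2])

lemma subsets: "K2 \<subseteq> K1" "P2 \<subseteq> P1" "P1 \<subseteq> carrier G"
  using sections K1 subgroup.subset[OF P1]
  by (auto simp: crossed_sections_def normal_in_subgroup_iff[OF P1]
      normal_in_subgroup_iff[OF subgroups(1)])

lemma conj_closed:
  "g \<in> P1 \<Longrightarrow> x \<in> P2 \<Longrightarrow> g \<otimes> x \<otimes> inv g \<in> P2"
  using sections by (auto simp: crossed_sections_def normal_in_subgroup_iff[OF P1])

lemma action_rcos:
  assumes "g \<in> P1" "x \<in> P2"
  shows "quot_conj G P2 K2 P1 K1 (K1 #> g) (K2 #> x) = K2 #> (g \<otimes> x \<otimes> inv g)"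
  using quot_conj_rcos[OF P1 P2 subgroups(1) subsets(2)] sections assms
  by (simp add: crossed_sections_def)

lemma boundary_rcos:
  assumes "x \<in> P2"
  shows "quot_boundary G P2 K2 K1 (K2 #> x) = K1 #> x"
  using quot_boundary_rcos[OF subgroups(2,1) subsets(1) _ assms] subgroup.subset[OF P2] .

text \<open>Conjugation by \<open>inv g\<close> is the inverse bijection.\<close>

lemma action_in_auto:
  assumes g: "g \<in> P1"
  shows "quot_conj G P2 K2 P1 K1 (K1 #> g) \<in> auto (quot G P2 K2)"
proof -
  let ?A = "quot G P2 K2"
  let ?act = "\<lambda>g. quot_conj G P2 K2 P1 K1 (K1 #> g)"
  note [simp del] = mult_FactGroup one_FactGroup
  have mem: "a \<in> carrier G" if "a \<in> P1 \<or> a \<in> P2" for a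
    using that subsets by blast
  have closed: "?act a C \<in> carrier ?A" if "a \<in> P1" "C \<in> carrier ?A" for a C
    using that by (auto simp: carrier_quot action_rcos conj_closed)
  have cancel: "?act (inv a) (?act a C) = C" if "a \<in> P1" "C \<in> carrier ?A" for a C
    using that P1
    by (auto simp: carrier_quot action_rcos conj_closed subgroup.m_inv_closed conj_inv_cancel mem)
  have "?act g \<in> hom ?A ?A"
  proof (rule homI)
    fix C D assume "C \<in> carrier ?A" "D \<in> carrier ?A"
    then obtain x y where "x \<in> P2" "C = K2 #> x" "y \<in> P2" "D = K2 #> y"
      by (auto simp: carrier_quot)
    then show "?act g (C \<otimes>\<^bsub>?A\<^esub> D) = ?act g C \<otimes>\<^bsub>?A\<^esub> ?act g D"
      using g by (simp add: quot_mult[OF P2 K2] action_rcos conj_closed conj_mult mem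
          subgroup.m_closed[OF P2])
  qed (rule closed[OF g])
  moreover have "bij_betw (?act g) (carrier ?A) (carrier ?A)"
  proof (rule bij_betw_byWitness[where f' = "?act (inv g)"])
    have inv: "inv g \<in> P1" using g P1 by (simp add: subgroup.m_inv_closed)
    show "\<forall>C\<in>carrier ?A. ?act (inv g) (?act g C) = C"
      using cancel[OF g] by blast
    show "\<forall>C\<in>carrier ?A. ?act g (?act (inv g) C) = C"
      using cancel[OF inv] g by (simp add: mem)
    show "?act g ` carrier ?A \<subseteq> carrier ?A" "?act (inv g) ` carrier ?A \<subseteq> carrier ?A"
      using closed g inv by auto
  qed
  moreover have "?act g \<in> extensional (carrier ?A)"
    by (simp add: quot_conj_def)
  ultimately show ?thesis
    by (simp add: auto_def Bij_def)
qed

text \<open>On coset representatives, each axiom is an identity between conjugates in \<open>G\<close>.\<close>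

lemma crossed_module_quot: "crossed_module (quot_xmod G P2 K2 P1 K1)"
proof -
  let ?A = "quot G P2 K2" and ?B = "quot G P1 K1"
  let ?act = "quot_conj G P2 K2 P1 K1" and ?d = "quot_boundary G P2 K2 K1"
  note [simp del] = mult_FactGroup one_FactGroup
  have mem: "a \<in> carrier G" if "a \<in> P1 \<or> a \<in> P2" for a
    using that subsets by blast
  note simps = quot_mult[OF P1 K1] quot_mult[OF P2 K2] quot_inv[OF P1 K1] quot_inv[OF P2 K2]
    subgroup.m_closed[OF P1] subgroup.m_closed[OF P2]
    subgroup.m_inv_closed[OF P1] subgroup.m_inv_closed[OF P2]
    action_rcos boundary_rcos conj_closed subsetD[OF subsets(2)]
  have "?act \<in> hom ?B (AutoGroup ?A)"
  proof (rule homI)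
    fix C assume "C \<in> carrier ?B"
    then show "?act C \<in> carrier (AutoGroup ?A)"
      by (auto simp: carrier_quot AutoGroup_def action_in_auto)
  next
    fix C D assume "C \<in> carrier ?B" "D \<in> carrier ?B"
    then obtain g h where gh: "g \<in> P1" "C = K1 #> g" "h \<in> P1" "D = K1 #> h"
      by (auto simp: carrier_quot)
    have "?act (C \<otimes>\<^bsub>?B\<^esub> D) = compose (carrier ?A) (?act C) (?act D)"
    proof (rule extensionalityI)
      fix X assume "X \<in> carrier ?A"
      moreover from this obtain x where x: "x \<in> P2" "X = K2 #> x"
        by (auto simp: carrier_quot)
      have "(g \<otimes> h) \<otimes> x \<otimes> inv (g \<otimes> h) = g \<otimes> (h \<otimes> x \<otimes> inv h) \<otimes> inv g"
        using gh x by (simp add: m_assoc inv_mult_group mem)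
      then have "?act (C \<otimes>\<^bsub>?B\<^esub> D) X = ?act C (?act D X)"
        using gh x by (simp add: simps)
      ultimately show "?act (C \<otimes>\<^bsub>?B\<^esub> D) X = compose (carrier ?A) (?act C) (?act D) X"
        by (simp add: compose_def)
    qed (simp_all add: quot_conj_def compose_extensional)
    moreover have "?act C \<in> Bij (carrier ?A)" "?act D \<in> Bij (carrier ?A)"
      using action_in_auto gh by (auto simp: auto_def)
    ultimately show "?act (C \<otimes>\<^bsub>?B\<^esub> D) = ?act C \<otimes>\<^bsub>AutoGroup ?A\<^esub> ?act D"
      by (simp add: AutoGroup_def BijGroup_def)
  qed
  moreover have "?d \<in> hom ?A ?B"
  proof (rule homI)
    show "?d C \<in> carrier ?B" if "C \<in> carrier ?A" for C
      using that by (auto simp: carrier_quot simps)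
    fix C D assume "C \<in> carrier ?A" "D \<in> carrier ?A"
    then obtain x y where "x \<in> P2" "C = K2 #> x" "y \<in> P2" "D = K2 #> y"
      by (auto simp: carrier_quot)
    then show "?d (C \<otimes>\<^bsub>?A\<^esub> D) = ?d C \<otimes>\<^bsub>?B\<^esub> ?d D"
      by (simp add: simps)
  qed
  moreover have "?d (?act C X) = C \<otimes>\<^bsub>?B\<^esub> ?d X \<otimes>\<^bsub>?B\<^esub> inv\<^bsub>?B\<^esub> C"
    if C: "C \<in> carrier ?B" and X: "X \<in> carrier ?A" for C X
  proof -
    obtain g x where "g \<in> P1" "C = K1 #> g" "x \<in> P2" "X = K2 #> x"
      using C X by (auto simp: carrier_quot)
    then show ?thesis
      by (simp add: simps)
  qed
  moreover have "?act (?d Y) X = Y \<otimes>\<^bsub>?A\<^esub> X \<otimes>\<^bsub>?A\<^esub> inv\<^bsub>?A\<^esub> Y"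
    if Y: "Y \<in> carrier ?A" and X: "X \<in> carrier ?A" for X Y
  proof -
    obtain y x where "y \<in> P2" "Y = K2 #> y" "x \<in> P2" "X = K2 #> x"
      using Y X by (auto simp: carrier_quot)
    then show ?thesis
      by (simp add: simps)
  qed
  ultimately show ?thesis
    using group_quot[OF P1 K1] group_quot[OF P2 K2]
    by (simp add: crossed_module_def quot_xmod_def)
qed

end


section \<open>Normality of one subgroup of a direct product in another\<close>

locale goursat_subgroup_pair = T: goursat_subgroup G H T + S: goursat_subgroup G H S
  for G :: "('a, 'm) monoid_scheme" and H :: "('b, 'n) monoid_scheme" and T S
begin

lemma normal_iff_conj_closed:
  "S \<lhd> (G \<times>\<times> H)\<lparr>carrier := T\<rparr> \<longleftrightarrow> S \<subseteq> T \<and>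
    (\<forall>g h x y. (g, h) \<in> T \<longrightarrow> (x, y) \<in> S \<longrightarrow>
      (g \<otimes>\<^bsub>G\<^esub> x \<otimes>\<^bsub>G\<^esub> inv\<^bsub>G\<^esub> g, h \<otimes>\<^bsub>H\<^esub> y \<otimes>\<^bsub>H\<^esub> inv\<^bsub>H\<^esub> h) \<in> S)"
proof -
  interpret GH: group "G \<times>\<times> H"
    by (intro DirProd_group T.G.group_axioms T.H.group_axioms)
  have conj: "(g, h) \<otimes>\<^bsub>G \<times>\<times> H\<^esub> (x, y) \<otimes>\<^bsub>G \<times>\<times> H\<^esub> inv\<^bsub>G \<times>\<times> H\<^esub> (g, h)
    = (g \<otimes>\<^bsub>G\<^esub> x \<otimes>\<^bsub>G\<^esub> inv\<^bsub>G\<^esub> g, h \<otimes>\<^bsub>H\<^esub> y \<otimes>\<^bsub>H\<^esub> inv\<^bsub>H\<^esub> h)"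
    if "(g, h) \<in> T" for g h x y
    using T.mem_carrier[OF that] by (simp add: inv_DirProd[OF T.G.group_axioms T.H.group_axioms])
  show ?thesis
    unfolding GH.normal_in_subgroup_iff[OF T.U.subgroup_axioms]
    using conj S.U.subgroup_axioms by (fastforce simp del: mult_DirProd)
qed

text \<open>All conditions follow by looking at one component of a conjugate in \<open>S\<close>.\<close>

lemma crossed_sections_fst_if_normal:
  assumes "S \<lhd> (G \<times>\<times> H)\<lparr>carrier := T\<rparr>"
  shows "crossed_sections G T.P T.K S.P S.K"
proof -
  from assms have sub: "S \<subseteq> T"
    and conj: "\<And>g h x y. (g, h) \<in> T \<Longrightarrow> (x, y) \<in> S \<Longrightarrow>
      (g \<otimes>\<^bsub>G\<^esub> x \<otimes>\<^bsub>G\<^esub> inv\<^bsub>G\<^esub> g, h \<otimes>\<^bsub>H\<^esub> y \<otimes>\<^bsub>H\<^esub> inv\<^bsub>H\<^esub> h) \<in> S"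
    by (auto simp: normal_iff_conj_closed)
  have sub_PK: "S.P \<subseteq> T.P" "S.K \<subseteq> T.K" "S.K \<subseteq> T.P"
    using sub S.mem_P_iff T.mem_P_iff S.mem_K_iff T.mem_K_iff by blast+
  have conj_P: "g \<otimes>\<^bsub>G\<^esub> x \<otimes>\<^bsub>G\<^esub> inv\<^bsub>G\<^esub> g \<in> S.P" if "g \<in> T.P" "x \<in> S.P" for g x
    using that conj unfolding S.mem_P_iff T.mem_P_iff by blast
  have conj_K: "g \<otimes>\<^bsub>G\<^esub> x \<otimes>\<^bsub>G\<^esub> inv\<^bsub>G\<^esub> g \<in> S.K" if "g \<in> T.P" "x \<in> S.K" for g x
  proof -
    obtain h where h: "(g, h) \<in> T" using \<open>g \<in> T.P\<close> T.mem_P_iff by blast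
    then show ?thesis
      using conj[OF h, of x "\<one>\<^bsub>H\<^esub>"] that T.mem_carrier[OF h] by (simp add: S.mem_K_iff)
  qed
  have "commutator_subgroup G T.K S.P \<subseteq> S.K"
  proof (rule T.G.commutator_subgroup_subset[OF S.subgroup_K])
    fix k p assume "k \<in> T.K" "p \<in> S.P"
    then obtain q where k: "(k, \<one>\<^bsub>H\<^esub>) \<in> T" and pq: "(p, q) \<in> S"
      by (auto simp: T.mem_K_iff S.mem_P_iff)
    \<comment> \<open>The second component of \<open>[(k, 1), (p, q)]\<close> is trivial.\<close>
    from S.mult_mem[OF conj[OF k pq] S.inv_mem[OF pq]]
    show "k \<otimes>\<^bsub>G\<^esub> p \<otimes>\<^bsub>G\<^esub> inv\<^bsub>G\<^esub> k \<otimes>\<^bsub>G\<^esub> inv\<^bsub>G\<^esub> p \<in> S.K"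
      using S.mem_carrier[OF pq] by (simp add: S.mem_K_iff)
  qed
  then show ?thesis
    using sub_PK conj_P conj_K S.subgroup_P S.subgroup_K T.normal_K
    by (auto simp: crossed_sections_def T.G.normal_in_subgroup_iff[OF T.subgroup_P]
        T.G.normal_in_subgroup_iff[OF T.subgroup_K])
qed

lemma goursat_subgroup_pair_converse: "goursat_subgroup_pair H G (T\<inverse>) (S\<inverse>)"
  by (intro goursat_subgroup_pair.intro T.goursat_subgroup_converse S.goursat_subgroup_converse)

lemma normal_converse:
  assumes "S \<lhd> (G \<times>\<times> H)\<lparr>carrier := T\<rparr>"
  shows "S\<inverse> \<lhd> (H \<times>\<times> G)\<lparr>carrier := T\<inverse>\<rparr>"
  using assms unfolding normal_iff_conj_closed
    goursat_subgroup_pair.normal_iff_conj_closed[OF goursat_subgroup_pair_converse]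
  by blast

lemma crossed_sections_snd_if_normal:
  assumes "S \<lhd> (G \<times>\<times> H)\<lparr>carrier := T\<rparr>"
  shows "crossed_sections H T.Q T.L S.Q S.L"
  using goursat_subgroup_pair.crossed_sections_fst_if_normal[OF goursat_subgroup_pair_converse
      normal_converse[OF assms]]
  by (simp only: T.converse_eqs S.converse_eqs)

lemma crossed_section_pair_fst:
  assumes "crossed_sections G T.P T.K S.P S.K"
  shows "crossed_section_pair G T.P T.K S.P S.K"
  using assms T.subgroup_P T.normal_K S.subgroup_P S.normal_K
  by (intro crossed_section_pair.intro crossed_section_pair_axioms.intro T.G.group_axioms) auto

lemma crossed_section_pair_snd:
  assumes "crossed_sections H T.Q T.L S.Q S.L"
  shows "crossed_section_pair H T.Q T.L S.Q S.L"
  using assms T.subgroup_Q T.normal_L S.subgroup_Q S.normal_L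
  by (intro crossed_section_pair.intro crossed_section_pair_axioms.intro T.H.group_axioms) auto

text \<open>Both sides imply that the two crossed modules are well defined. Given this, compatibility
  of \<open>(\<eta>2, \<eta>1)\<close> with the boundary maps at \<open>L2 y\<close>, where \<open>(x, y) \<in> S\<close>, is the equation
  \<open>\<eta>1 (L1 y) = K1 x\<close>, that is, \<open>(x, y) \<in> T\<close>. Compatibility with the actions at \<open>L1 h\<close> and
  \<open>L2 y\<close>, where also \<open>(g, h) \<in> T\<close>, is the equation
  \<open>\<eta>2 (L2 (h y h\<inverse>)) = K2 (g x g\<inverse>)\<close>, that is, the conjugate of \<open>(x, y)\<close> by \<open>(g, h)\<close> lies
  in \<open>S\<close>.\<close>

theorem normal_iff_xmod_iso:
  "S \<lhd> (G \<times>\<times> H)\<lparr>carrier := T\<rparr> \<longleftrightarrow>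
     crossed_sections G T.P T.K S.P S.K \<and> crossed_sections H T.Q T.L S.Q S.L \<and>
     (S.\<eta>, T.\<eta>) \<in> xmod_iso (quot_xmod H S.Q S.L T.Q T.L) (quot_xmod G S.P S.K T.P T.K)"
  (is "_ \<longleftrightarrow> ?cG \<and> ?cH \<and> ?iso")
proof (cases "?cG \<and> ?cH")
  case False
  then show ?thesis
    using crossed_sections_fst_if_normal crossed_sections_snd_if_normal by blast
next
  case True
  interpret cG: crossed_section_pair G T.P T.K S.P S.K
    using True crossed_section_pair_fst by blast
  interpret cH: crossed_section_pair H T.Q T.L S.Q S.L
    using True crossed_section_pair_snd by blast
  have boundary: "quot_boundary G S.P S.K T.K (S.\<eta> (S.L #>\<^bsub>H\<^esub> y)) = T.K #>\<^bsub>G\<^esub> x"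
    "T.\<eta> (quot_boundary H S.Q S.L T.L (S.L #>\<^bsub>H\<^esub> y)) = T.\<eta> (T.L #>\<^bsub>H\<^esub> y)"
    "x \<in> T.P" "y \<in> T.Q"
    if xy: "(x, y) \<in> S" for x y
  proof -
    have "x \<in> S.P" "y \<in> S.Q" using xy S.mem_P_iff S.mem_Q_iff by blast+
    then show "quot_boundary G S.P S.K T.K (S.\<eta> (S.L #>\<^bsub>H\<^esub> y)) = T.K #>\<^bsub>G\<^esub> x"
      "T.\<eta> (quot_boundary H S.Q S.L T.L (S.L #>\<^bsub>H\<^esub> y)) = T.\<eta> (T.L #>\<^bsub>H\<^esub> y)"
      "x \<in> T.P" "y \<in> T.Q"
      using cG.subsets cH.subsets
      by (auto simp: cG.boundary_rcos cH.boundary_rcos S.eta_rcos[OF xy])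
  qed
  have action:
    "S.\<eta> (quot_conj H S.Q S.L T.Q T.L (T.L #>\<^bsub>H\<^esub> h) (S.L #>\<^bsub>H\<^esub> y))
      = S.\<eta> (S.L #>\<^bsub>H\<^esub> (h \<otimes>\<^bsub>H\<^esub> y \<otimes>\<^bsub>H\<^esub> inv\<^bsub>H\<^esub> h))"
    "quot_conj G S.P S.K T.P T.K (T.\<eta> (T.L #>\<^bsub>H\<^esub> h)) (S.\<eta> (S.L #>\<^bsub>H\<^esub> y))
      = S.K #>\<^bsub>G\<^esub> (g \<otimes>\<^bsub>G\<^esub> x \<otimes>\<^bsub>G\<^esub> inv\<^bsub>G\<^esub> g)"
    "g \<otimes>\<^bsub>G\<^esub> x \<otimes>\<^bsub>G\<^esub> inv\<^bsub>G\<^esub> g \<in> S.P" "h \<otimes>\<^bsub>H\<^esub> y \<otimes>\<^bsub>H\<^esub> inv\<^bsub>H\<^esub> h \<in> S.Q"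
    if gh: "(g, h) \<in> T" and xy: "(x, y) \<in> S" for g h x y
  proof -
    have "x \<in> S.P" "y \<in> S.Q" "g \<in> T.P" "h \<in> T.Q"
      using gh xy S.mem_P_iff S.mem_Q_iff T.mem_P_iff T.mem_Q_iff by blast+
    then show
      "S.\<eta> (quot_conj H S.Q S.L T.Q T.L (T.L #>\<^bsub>H\<^esub> h) (S.L #>\<^bsub>H\<^esub> y))
        = S.\<eta> (S.L #>\<^bsub>H\<^esub> (h \<otimes>\<^bsub>H\<^esub> y \<otimes>\<^bsub>H\<^esub> inv\<^bsub>H\<^esub> h))"
      "quot_conj G S.P S.K T.P T.K (T.\<eta> (T.L #>\<^bsub>H\<^esub> h)) (S.\<eta> (S.L #>\<^bsub>H\<^esub> y))
        = S.K #>\<^bsub>G\<^esub> (g \<otimes>\<^bsub>G\<^esub> x \<otimes>\<^bsub>G\<^esub> inv\<^bsub>G\<^esub> g)"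
      "g \<otimes>\<^bsub>G\<^esub> x \<otimes>\<^bsub>G\<^esub> inv\<^bsub>G\<^esub> g \<in> S.P" "h \<otimes>\<^bsub>H\<^esub> y \<otimes>\<^bsub>H\<^esub> inv\<^bsub>H\<^esub> h \<in> S.Q"
      by (simp_all add: cG.action_rcos cH.action_rcos S.eta_rcos[OF xy] T.eta_rcos[OF gh]
          cG.conj_closed cH.conj_closed)
  qed
  let ?compatible = "\<forall>Y\<in>carrier (quot H S.Q S.L).
    quot_boundary G S.P S.K T.K (S.\<eta> Y) = T.\<eta> (quot_boundary H S.Q S.L T.L Y)"
  let ?equivariant = "\<forall>C\<in>carrier (quot H T.Q T.L). \<forall>Y\<in>carrier (quot H S.Q S.L).
    S.\<eta> (quot_conj H S.Q S.L T.Q T.L C Y) = quot_conj G S.P S.K T.P T.K (T.\<eta> C) (S.\<eta> Y)"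
  \<comment> \<open>Quantifying over cosets in \<open>Q2/L2\<close> and \<open>Q1/L1\<close> is quantifying over elements of \<open>S\<close> and \<open>T\<close>.\<close>
  have rep: "(\<forall>Y\<in>carrier (quot H S.Q S.L). F Y) \<longleftrightarrow> (\<forall>x y. (x, y) \<in> S \<longrightarrow> F (S.L #>\<^bsub>H\<^esub> y))"
    "(\<forall>C\<in>carrier (quot H T.Q T.L). F C) \<longleftrightarrow> (\<forall>g h. (g, h) \<in> T \<longrightarrow> F (T.L #>\<^bsub>H\<^esub> h))" for F
    unfolding T.H.carrier_quot S.mem_Q_iff T.mem_Q_iff by (auto simp: S.mem_Q_iff T.mem_Q_iff)
  have "?compatible \<longleftrightarrow> S \<subseteq> T"
  proof -
    have "(x, y) \<in> T \<longleftrightarrow>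
        quot_boundary G S.P S.K T.K (S.\<eta> (S.L #>\<^bsub>H\<^esub> y))
          = T.\<eta> (quot_boundary H S.Q S.L T.L (S.L #>\<^bsub>H\<^esub> y))" if "(x, y) \<in> S" for x y
      using boundary[OF that] T.mem_iff_eta[of x y] by auto
    then show ?thesis
      unfolding rep by (auto simp: subset_iff)
  qed
  moreover have "?equivariant \<longleftrightarrow> (\<forall>g h x y. (g, h) \<in> T \<longrightarrow> (x, y) \<in> S \<longrightarrow>
      (g \<otimes>\<^bsub>G\<^esub> x \<otimes>\<^bsub>G\<^esub> inv\<^bsub>G\<^esub> g, h \<otimes>\<^bsub>H\<^esub> y \<otimes>\<^bsub>H\<^esub> inv\<^bsub>H\<^esub> h) \<in> S)"
  proof -
    have "(g \<otimes>\<^bsub>G\<^esub> x \<otimes>\<^bsub>G\<^esub> inv\<^bsub>G\<^esub> g, h \<otimes>\<^bsub>H\<^esub> y \<otimes>\<^bsub>H\<^esub> inv\<^bsub>H\<^esub> h) \<in> S \<longleftrightarrow>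
        S.\<eta> (quot_conj H S.Q S.L T.Q T.L (T.L #>\<^bsub>H\<^esub> h) (S.L #>\<^bsub>H\<^esub> y))
          = quot_conj G S.P S.K T.P T.K (T.\<eta> (T.L #>\<^bsub>H\<^esub> h)) (S.\<eta> (S.L #>\<^bsub>H\<^esub> y))"
      if "(g, h) \<in> T" "(x, y) \<in> S" for g h x y
      unfolding action[OF that] by (subst S.mem_iff_eta) (simp add: action(3,4)[OF that])
    then show ?thesis
      unfolding rep by blast
  qed
  moreover have "?iso \<longleftrightarrow> ?compatible \<and> ?equivariant"
    using S.eta_iso T.eta_iso by (auto simp: xmod_iso_def xmod_hom_def quot_xmod_def iso_def)
  ultimately show ?thesis
    using True normal_iff_conj_closed by simp
qed

end


section \<open>Sections of a direct product\<close>

text \<open>Goursat's correspondence, applied to both entries, is a bijection from pairs of subgroups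
  to pairs of quintuples. It restricts to the pairs in question because the conditions on the pair
  of correspondents hold exactly for those \<open>(T, S)\<close> with \<open>S\<close> normal in \<open>T\<close>.\<close>

theorem theorem3p6:
  fixes G :: "('a, 'm) monoid_scheme" and H :: "('b, 'n) monoid_scheme"
  assumes "group G" and "group H"
    and "finite (carrier G)" and "finite (carrier H)"
  shows "bij_betw (\<lambda>(T, S). (goursat_correspondent G H T, goursat_correspondent G H S))
    (sections (G \<times>\<times> H))
    {((P1, K1, \<eta>1, L1, Q1), (P2, K2, \<eta>2, L2, Q2)).
       (P1, K1, \<eta>1, L1, Q1) \<in> goursat_quintuples G H \<and>
       (P2, K2, \<eta>2, L2, Q2) \<in> goursat_quintuples G H \<and>
       (K2 \<lhd> G\<lparr>carrier := K1\<rparr> \<and> L2 \<lhd> H\<lparr>carrier := L1\<rparr>) \<and>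
       (K2 \<lhd> G\<lparr>carrier := P1\<rparr> \<and> P2 \<lhd> G\<lparr>carrier := P1\<rparr> \<and>
        L2 \<lhd> H\<lparr>carrier := Q1\<rparr> \<and> Q2 \<lhd> H\<lparr>carrier := Q1\<rparr>) \<and>
       (commutator_subgroup G K1 P2 \<subseteq> K2 \<and> commutator_subgroup H L1 Q2 \<subseteq> L2) \<and>
       (crossed_module (quot_xmod G P2 K2 P1 K1) \<and>
        crossed_module (quot_xmod H Q2 L2 Q1 L1)) \<and>
       (\<eta>2, \<eta>1) \<in> xmod_iso (quot_xmod H Q2 L2 Q1 L1) (quot_xmod G P2 K2 P1 K1)}"
proof -
  interpret G: group G by fact
  interpret H: group H by fact
  interpret GH: group "G \<times>\<times> H"
    by (intro DirProd_group assms)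
  let ?sub = "{U. subgroup U (G \<times>\<times> H)}"
  let ?cor = "goursat_correspondent G H"
  let ?conds = "\<lambda>((P1, K1, \<eta>1, L1, Q1), (P2, K2, \<eta>2, L2, Q2)).
    crossed_sections G P1 K1 P2 K2 \<and> crossed_sections H Q1 L1 Q2 L2 \<and>
    crossed_module (quot_xmod G P2 K2 P1 K1) \<and> crossed_module (quot_xmod H Q2 L2 Q1 L1) \<and>
    (\<eta>2, \<eta>1) \<in> xmod_iso (quot_xmod H Q2 L2 Q1 L1) (quot_xmod G P2 K2 P1 K1)"
  have conds_iff: "?conds (?cor T, ?cor S) \<longleftrightarrow> S \<lhd> (G \<times>\<times> H)\<lparr>carrier := T\<rparr>"
    if "T \<in> ?sub" "S \<in> ?sub" for T S
  proof -
    interpret goursat_subgroup_pair G H T S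
      using that
      by (intro goursat_subgroup_pair.intro goursat_subgroup.intro G.group_axioms H.group_axioms)
        auto
    show ?thesis
      using crossed_section_pair.crossed_module_quot[OF crossed_section_pair_fst]
        crossed_section_pair.crossed_module_quot[OF crossed_section_pair_snd]
      unfolding normal_iff_xmod_iso goursat_correspondent_def by auto
  qed
  have "bij_betw (map_prod ?cor ?cor) (?sub \<times> ?sub)
      (goursat_quintuples G H \<times> goursat_quintuples G H)"
    by (intro bij_betw_map_prod goursat_bij assms)
  then have "bij_betw (map_prod ?cor ?cor)
      {p \<in> ?sub \<times> ?sub. snd p \<lhd> (G \<times>\<times> H)\<lparr>carrier := fst p\<rparr>}
      {q \<in> goursat_quintuples G H \<times> goursat_quintuples G H. ?conds q}"
  proof (rule bij_betw_Collect)
    fix p assume "p \<in> ?sub \<times> ?sub"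
    then show "?conds (map_prod ?cor ?cor p) \<longleftrightarrow> snd p \<lhd> (G \<times>\<times> H)\<lparr>carrier := fst p\<rparr>"
      using conds_iff[of "fst p" "snd p"] by (cases p) simp
  qed
  moreover have "{p \<in> ?sub \<times> ?sub. snd p \<lhd> (G \<times>\<times> H)\<lparr>carrier := fst p\<rparr>} = sections (G \<times>\<times> H)"
    by (auto simp: sections_def GH.normal_in_subgroup_iff)
  moreover have "map_prod ?cor ?cor = (\<lambda>(T, S). (?cor T, ?cor S))"
    by auto
  ultimately show ?thesis
    by (auto simp: crossed_sections_def elim!: back_subst[where P = "bij_betw _ _"])
qed

end
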